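(* Let $G$ be a graph with $\alpha(G) = 2$. Then $\chi_{\rho}(G) = \Delta(G) - \alpha(G) + 2$ if and only if $\Delta(G) = n(G)-1$ or $G\in \mathcal{H}$.
   Context: All graphs are finite and simple; $n(G)$ is the number of vertices, $\alpha(G)$ the independence number and $\Delta(G)$ the maximum degree of $G$. For a positive integer $i$, an $i$-packing in $G$ is a set $W\subseteq V(G)$ such that any two distinct vertices of $W$ are at distance greater than $i$ in $G$. The packing chromatic number $\chi_{\rho}(G)$ is the smallest integer $k$ such that $V(G)$ can be partitioned into sets $V_1,\dots,V_k$ with $V_i$ an $i$-packing for each $i\in\{1,\dots,k\}$. The class $\mathcal{H}$ consists of all graphs $H$ obtained as follows. Let $r\ge 3$ and $s\ge 2$ be integers. Let $A$ be a complete graph of order $r$ with three specified distinct vertices $a_1,a_2,a$, and let $B$ be a complete graph of order $s$ with two specified distinct vertices $b,b_1$. Take the disjoint union of $A$, $B$ and a new vertex $z$; add an edge between $z$ and every vertex of $B\setminus\{b\}$; then identify the vertices $a$ and $b$ into a single vertex $w$. The resulting graph has order $r+s$. Finally, any subset of the missing edges may be added, provided that no added edge is $a_1b_1$ and no added edge is incident to $z$ or to $a_2$. Every graph arising in this way belongs to $\mathcal{H}$. *)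

theory Defs
  imports "Graph_Theory.Graph_Theory" "HOL-Library.Disjoint_Sets"
begin

text \<open>
  A finite simple graph is a \<^term>\<open>pair_graph\<close>: a finite, symmetric, loop-free relation on a finite
  vertex set. An undirected edge \<open>uv\<close> is the pair of arcs \<open>(u, v)\<close> and \<open>(v, u)\<close>, so the degree of a
  vertex is its out-degree.
\<close>

definition graph_order :: "'a pair_pre_digraph \<Rightarrow> nat" where
  "graph_order G = card (pverts G)"

definition max_degree :: "'a pair_pre_digraph \<Rightarrow> nat" where
  "max_degree G = Max (out_degree (with_proj G) ` pverts G)"

definition independent_set :: "'a pair_pre_digraph \<Rightarrow> 'a set \<Rightarrow> bool" where
  "independent_set G S \<longleftrightarrow> S \<subseteq> pverts G \<and> (\<forall>u\<in>S. \<forall>v\<in>S. (u, v) \<notin> parcs G)"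

definition independence_number :: "'a pair_pre_digraph \<Rightarrow> nat" where
  "independence_number G = Max {card S | S. independent_set G S}"

text \<open>Shortest-path cost for unit weights; vertices in different components have distance \<open>\<infinity>\<close>.\<close>

definition distance :: "'a pair_pre_digraph \<Rightarrow> 'a \<Rightarrow> 'a \<Rightarrow> ereal" where
  "distance G u v = wf_digraph.\<mu> (with_proj G) (\<lambda>_. 1) u v"

definition packing :: "'a pair_pre_digraph \<Rightarrow> nat \<Rightarrow> 'a set \<Rightarrow> bool" where
  "packing G i W \<longleftrightarrow>
     W \<subseteq> pverts G \<and> (\<forall>u\<in>W. \<forall>v\<in>W. u \<noteq> v \<longrightarrow> ereal (real i) < distance G u v)"

text \<open>
  Empty classes are admitted; this does not change the minimum, since a \<open>k\<close>-packing is an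
  \<open>i\<close>-packing for every \<open>i \<le> k\<close>, so that the last class could replace an empty one.
\<close>

definition packing_colouring :: "'a pair_pre_digraph \<Rightarrow> nat \<Rightarrow> (nat \<Rightarrow> 'a set) \<Rightarrow> bool" where
  "packing_colouring G k W \<longleftrightarrow>
     (\<Union>i\<in>{1..k}. W i) = pverts G \<and> disjoint_family_on W {1..k} \<and>
     (\<forall>i\<in>{1..k}. packing G i (W i))"

definition packing_chromatic_number :: "'a pair_pre_digraph \<Rightarrow> nat" where
  "packing_chromatic_number G = (LEAST k. \<exists>W. packing_colouring G k W)"

text \<open>
  The identification of \<open>a\<close> with \<open>b\<close> is encoded by taking cliques \<open>A\<close> and \<open>B\<close> that share exactly
  the vertex \<open>w\<close>.
\<close>

definition H_base ::
    "'a pair_pre_digraph \<Rightarrow> 'a pair_pre_digraph \<Rightarrow> 'a \<Rightarrow> 'a \<Rightarrow> 'a pair_pre_digraph" where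
  "H_base A B w z =
     \<lparr> pverts = pverts A \<union> pverts B \<union> {z},
       parcs = parcs A \<union> parcs B \<union> {z} \<times> (pverts B - {w}) \<union> (pverts B - {w}) \<times> {z} \<rparr>"

definition missing_edges :: "'a pair_pre_digraph \<Rightarrow> 'a rel" where
  "missing_edges G = {(u, v). u \<in> pverts G \<and> v \<in> pverts G \<and> u \<noteq> v \<and> (u, v) \<notin> parcs G}"

text \<open>
  The vertices of \<open>A\<close> and \<open>B\<close> range over the whole vertex type, so the class is closed under
  isomorphism. \<open>F\<close> is the (symmetric) set of edges added at the end.
\<close>

definition class_H :: "'a pair_pre_digraph set" where
  "class_H = {G. \<exists>r s A B w z a1 a2 b1 F.
     r \<ge> 3 \<and> s \<ge> 2 \<and>
     complete_digraph r (with_proj A) \<and> complete_digraph s (with_proj B) \<and>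
     pverts A \<inter> pverts B = {w} \<and> z \<notin> pverts A \<union> pverts B \<and>
     a1 \<in> pverts A \<and> a2 \<in> pverts A \<and> distinct [a1, a2, w] \<and>
     b1 \<in> pverts B \<and> b1 \<noteq> w \<and>
     F \<subseteq> missing_edges (H_base A B w z) \<and> sym F \<and>
     (a1, b1) \<notin> F \<and> (\<forall>(u, v)\<in>F. u \<notin> {z, a2} \<and> v \<notin> {z, a2}) \<and>
     G = \<lparr> pverts = pverts (H_base A B w z), parcs = parcs (H_base A B w z) \<union> F \<rparr>}"

end

theory Submission
  imports Defs
begin

text \<open>
  If \<open>\<alpha>(G) = 2\<close>, every colour class has at most two vertices, so \<open>n \<le> k + c\<close> where \<open>c\<close> counts the
  classes of size two. A class \<open>V\<^sub>i\<close> with \<open>i \<ge> 3\<close> has size two only if \<open>G\<close> is a disjoint union of two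
  cliques, and then \<open>k > \<Delta>\<close>; otherwise \<open>c \<le> 2\<close>. Hence \<open>\<chi>\<^sub>\<rho> = \<Delta> \<le> n - 2\<close> forces \<open>\<Delta> = n - 2\<close>, a nonadjacent
  pair \<open>V\<^sub>1\<close> and a disjoint pair \<open>V\<^sub>2 = {z, a\<^sub>2}\<close> at distance three. The closed neighbourhoods of \<open>z\<close>
  and \<open>a\<^sub>2\<close> are cliques that partition the vertices, a vertex of degree \<open>n - 2\<close> misses exactly one of
  \<open>z, a\<^sub>2\<close> and serves as \<open>w\<close>, and \<open>V\<^sub>1\<close> provides \<open>a\<^sub>1, b\<^sub>1\<close>. Conversely, a dominating vertex makes all
  distances at most two, so \<open>c \<le> 1\<close>, and in a graph of \<open>\<H>\<close> all distances are at most three, so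
  \<open>c \<le> 2\<close>; colourings attaining these bounds are immediate.
\<close>

section \<open>Distances and packings expressed by walks of bounded length\<close>

context pair_wf_digraph
begin

lemma relpow_parcs_iff_awalk:
  assumes "u \<in> pverts G"
  shows "(u, v) \<in> parcs G ^^ n \<longleftrightarrow> (\<exists>p. awalk u p v \<and> length p = n)"
  using assms
proof (induction n arbitrary: u)
  case 0
  then show ?case by (auto simp: awalk_Nil_iff)
next
  case (Suc n)
  show ?case
  proof
    assume "(u, v) \<in> parcs G ^^ Suc n"
    then obtain x where x: "(u, x) \<in> parcs G" "(x, v) \<in> parcs G ^^ n"
      by (blast dest: relpow_Suc_D2)
    then obtain p where "awalk x p v" "length p = n"
      using Suc.IH[of x] in_arcsD2 by blast
    with x have "awalk u ((u, x) # p) v \<and> length ((u, x) # p) = Suc n"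
      by (simp add: awalk_Cons_iff)
    then show "\<exists>p. awalk u p v \<and> length p = Suc n" by blast
  next
    assume "\<exists>p. awalk u p v \<and> length p = Suc n"
    then obtain e p where "awalk u (e # p) v" "length p = n"
      by (metis length_Suc_conv)
    then have e: "e \<in> parcs G" "fst e = u" "awalk (snd e) p v"
      by (auto simp: awalk_Cons_iff)
    with \<open>length p = n\<close> have "(snd e, v) \<in> parcs G ^^ n"
      using Suc.IH[of "snd e"] arc_snd_in_verts by blast
    with e show "(u, v) \<in> parcs G ^^ Suc n"
      by (metis prod.collapse relpow_Suc_I2)
  qed
qed

lemma less_distance_iff:
  assumes "u \<in> pverts G"
  shows "ereal (real i) < distance G u v \<longleftrightarrow> (\<forall>n\<le>i. (u, v) \<notin> parcs G ^^ n)"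
proof -
  have cost: "awalk_cost (\<lambda>_. 1) p = real (length p)" for p
    by (induction p) auto
  have dist: "distance G u v = (INF p\<in>{p. awalk u p v}. ereal (real (length p)))"
    by (simp add: distance_def \<mu>_def cost)
  show ?thesis
  proof
    assume less: "ereal (real i) < distance G u v"
    show "\<forall>n\<le>i. (u, v) \<notin> parcs G ^^ n"
    proof (intro allI impI notI)
      fix n assume "n \<le> i" "(u, v) \<in> parcs G ^^ n"
      then obtain p where "awalk u p v" "length p = n"
        using relpow_parcs_iff_awalk[OF assms] by blast
      then have "distance G u v \<le> ereal (real n)"
        unfolding dist by (intro INF_lower2[of p]) auto
      also have "\<dots> \<le> ereal (real i)" using \<open>n \<le> i\<close> by simp
      finally show False using less by simp
    qed
  next
    assume none: "\<forall>n\<le>i. (u, v) \<notin> parcs G ^^ n"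
    \<comment> \<open>An infimum preserves only weak bounds; strictness is recovered because walk
      lengths are integers, hence at least \<open>Suc i\<close>.\<close>
    have "ereal (real (Suc i)) \<le> distance G u v"
      unfolding dist
    proof (rule INF_greatest)
      fix p assume "p \<in> {p. awalk u p v}"
      then have "(u, v) \<in> parcs G ^^ length p"
        using relpow_parcs_iff_awalk[OF assms] by blast
      with none have "Suc i \<le> length p" by (metis not_less_eq_eq)
      then show "ereal (real (Suc i)) \<le> ereal (real (length p))" by simp
    qed
    moreover have "ereal (real i) < ereal (real (Suc i))" by simp
    ultimately show "ereal (real i) < distance G u v" by (rule less_le_trans[rotated])
  qed
qed

lemma packing_iff:
  "packing G i W \<longleftrightarrow>
     W \<subseteq> pverts G \<and> (\<forall>u\<in>W. \<forall>v\<in>W. u \<noteq> v \<longrightarrow> (\<forall>n\<le>i. (u, v) \<notin> parcs G ^^ n))"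
  unfolding packing_def using less_distance_iff by blast

lemma packing_relpowD:
  "\<lbrakk>packing G i W; u \<in> W; v \<in> W; u \<noteq> v; (u, v) \<in> parcs G ^^ n\<rbrakk> \<Longrightarrow> i < n"
  unfolding packing_iff using not_less by blast

lemma packing_not_adjacent:
  assumes "packing G i W" "1 \<le> i" "u \<in> W" "v \<in> W" "u \<noteq> v"
  shows "(u, v) \<notin> parcs G"
  using packing_relpowD[OF assms(1,3-5), of 1] assms(2) by auto

lemma packing_no_common_neighbour:
  assumes "packing G i W" "2 \<le> i" "u \<in> W" "v \<in> W" "u \<noteq> v" "(u, x) \<in> parcs G"
  shows "(x, v) \<notin> parcs G"
proof
  assume "(x, v) \<in> parcs G"
  with assms(6) have "(u, v) \<in> parcs G ^^ 2" by (auto simp: numeral_2_eq_2)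
  from packing_relpowD[OF assms(1,3-5) this] assms(2) show False by simp
qed

lemma packing_no_3_walk:
  assumes "packing G i W" "3 \<le> i" "u \<in> W" "v \<in> W" "u \<noteq> v"
    and "(u, x) \<in> parcs G" "(x, y) \<in> parcs G"
  shows "(y, v) \<notin> parcs G"
proof
  assume "(y, v) \<in> parcs G"
  with assms(6,7) have "(u, v) \<in> parcs G ^^ 3" by (auto simp: numeral_3_eq_3)
  from packing_relpowD[OF assms(1,3-5) this] assms(2) show False by simp
qed

lemma packing_1I:
  assumes "W \<subseteq> pverts G" "\<And>u v. \<lbrakk>u \<in> W; v \<in> W; u \<noteq> v\<rbrakk> \<Longrightarrow> (u, v) \<notin> parcs G"
  shows "packing G 1 W"
proof -
  have "(u, v) \<notin> parcs G ^^ n" if "u \<in> W" "v \<in> W" "u \<noteq> v" "n \<le> 1" for u v n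
  proof -
    from that(4) consider "n = 0" | "n = 1" by linarith
    then show ?thesis using that assms(2) by cases auto
  qed
  with assms(1) show ?thesis unfolding packing_iff by blast
qed

lemma packing_2I:
  assumes "W \<subseteq> pverts G" "\<And>u v. \<lbrakk>u \<in> W; v \<in> W; u \<noteq> v\<rbrakk> \<Longrightarrow> (u, v) \<notin> parcs G"
    and "\<And>u v x. \<lbrakk>u \<in> W; v \<in> W; u \<noteq> v; (u, x) \<in> parcs G\<rbrakk> \<Longrightarrow> (x, v) \<notin> parcs G"
  shows "packing G 2 W"
proof -
  have "(u, v) \<notin> parcs G ^^ n" if "u \<in> W" "v \<in> W" "u \<noteq> v" "n \<le> 2" for u v n
  proof -
    from that(4) consider "n = 0" | "n = 1" | "n = 2" by linarith
    then show ?thesis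
    proof cases
      case 3
      have "(u, v) \<notin> parcs G O parcs G" using assms(3)[OF that(1-3)] by blast
      with 3 show ?thesis by (simp add: numeral_2_eq_2)
    qed (use that(3) assms(2)[OF that(1-3)] in simp_all)
  qed
  with assms(1) show ?thesis unfolding packing_iff by blast
qed

end

section \<open>Colourings built from two prescribed classes\<close>

context pair_fin_digraph
begin

text \<open>A singleton is an \<open>i\<close>-packing for every \<open>i\<close>, so each vertex
  outside \<open>P\<close> and \<open>Q\<close> can receive a colour of its own.\<close>

lemma packing_colouring_extend:
  assumes "packing G 1 P" "packing G 2 Q" "P \<inter> Q = {}"
  shows "\<exists>W. packing_colouring G (2 + card (pverts G - (P \<union> Q))) W"
proof -
  let ?R = "pverts G - (P \<union> Q)" and ?k = "2 + card (pverts G - (P \<union> Q))"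
  have sub: "P \<subseteq> pverts G" "Q \<subseteq> pverts G"
    using assms by (auto simp: packing_def)
  obtain f where f: "bij_betw f {0..<card ?R} ?R"
    using ex_bij_betw_nat_finite[of ?R] pair_finite_verts by blast
  \<comment> \<open>Colours 1 and 2 are taken and \<open>f\<close> counts from 0, which explains the
    shift by 3.\<close>
  define W where "W i = (if i = 1 then P else if i = 2 then Q else {f (i - 3)})" for i :: nat
  have idx: "{1..?k} = {1, 2} \<union> (\<lambda>j. j + 3) ` {0..<card ?R}"
  proof -
    have "i \<in> {1, 2} \<union> (\<lambda>j. j + 3) ` {0..<card ?R}" if "i \<in> {1..?k}" for i
    proof (cases "i \<le> 2")
      case True
      with that show ?thesis by auto
    next
      case False
      with that have "i = (i - 3) + 3" "i - 3 \<in> {0..<card ?R}" by auto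
      then show ?thesis by blast
    qed
    then show ?thesis by auto
  qed
  have W: "W 1 = P" "W 2 = Q" "W (j + 3) = {f j}" for j
    by (simp_all add: W_def)
  have fR: "f j \<in> ?R" if "j < card ?R" for j
    using f that by (auto simp: bij_betw_def)
  have "(\<Union>i\<in>{1..?k}. W i) = P \<union> Q \<union> f ` {0..<card ?R}"
    by (simp only: idx UN_Un UN_insert UN_empty image_image W) auto
  also have "\<dots> = pverts G" using f sub by (auto simp: bij_betw_def)
  finally have cover: "(\<Union>i\<in>{1..?k}. W i) = pverts G" .
  have disj: "disjoint_family_on W {1..?k}"
    unfolding disjoint_family_on_def
  proof (intro ballI impI)
    fix i j assume i: "i \<in> {1..?k}" and j: "j \<in> {1..?k}" and "i \<noteq> j"
    have out: "f (l - 3) \<in> ?R" if "l \<in> {1..?k}" "l \<noteq> 1" "l \<noteq> 2" for l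
      using that by (intro fR) auto
    have inj: "f (i - 3) \<noteq> f (j - 3)" if "i \<noteq> 1" "i \<noteq> 2" "j \<noteq> 1" "j \<noteq> 2"
    proof
      assume "f (i - 3) = f (j - 3)"
      moreover have "i - 3 \<in> {0..<card ?R}" "j - 3 \<in> {0..<card ?R}" using that i j by auto
      ultimately have "i - 3 = j - 3" using f by (auto simp: bij_betw_def dest: inj_onD)
      with that i j \<open>i \<noteq> j\<close> show False by auto
    qed
    show "W i \<inter> W j = {}"
      using out[OF i] out[OF j] inj \<open>i \<noteq> j\<close> assms(3) by (auto simp: W_def)
  qed
  have "packing G i (W i)" if i: "i \<in> {1..?k}" for i
  proof -
    consider "i = 1" | "i = 2" | "i \<noteq> 1" "i \<noteq> 2" by blast
    then show ?thesis
    proof cases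
      case 3
      then have "f (i - 3) \<in> pverts G" using i fR[of "i - 3"] by auto
      with 3 show ?thesis by (simp add: W_def packing_def)
    qed (use assms in \<open>simp_all add: W_def\<close>)
  qed
  with cover disj show ?thesis unfolding packing_colouring_def by blast
qed

end

section \<open>Degrees and non-neighbours\<close>

context pair_graph
begin

definition non_neighbours :: "'a \<Rightarrow> 'a set" where
  "non_neighbours v = {u \<in> pverts G. u \<noteq> v \<and> (v, u) \<notin> parcs G}"

lemma arc_sym: "(u, v) \<in> parcs G \<Longrightarrow> (v, u) \<in> parcs G"
  using arcs_symmetric by blast

lemma no_loop: "(u, u) \<notin> parcs G"
  using pair_no_loops by fastforce

text \<open>The summand 1 is \<open>v\<close> itself. Large degrees can thus be read off from few
  non-neighbours: none for degree \<open>n - 1\<close>, exactly one for degree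
  \<open>n - 2\<close>.\<close>

lemma degree_complement:
  assumes "v \<in> pverts G"
  shows "out_degree (with_proj G) v + card (non_neighbours v) + 1 = graph_order G"
proof -
  have "out_arcs (with_proj G) v = Pair v ` (parcs G `` {v})"
    by (auto simp: out_arcs_def)
  then have deg: "out_degree (with_proj G) v = card (parcs G `` {v})"
    by (simp add: out_degree_def card_image inj_on_def)
  have fin: "finite (parcs G `` {v})" "finite (non_neighbours v)"
    using pair_finite_verts
    by (auto simp: non_neighbours_def dest: in_arcsD2 intro: finite_subset[of _ "pverts G"])
  have "pverts G = insert v (parcs G `` {v} \<union> non_neighbours v)"
    using assms by (auto simp: non_neighbours_def dest: in_arcsD2)
  moreover have "v \<notin> parcs G `` {v} \<union> non_neighbours v"
    by (auto simp: non_neighbours_def no_loop)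
  moreover have "card (parcs G `` {v} \<union> non_neighbours v)
      = card (parcs G `` {v}) + card (non_neighbours v)"
    using fin by (intro card_Un_disjoint) (auto simp: non_neighbours_def)
  ultimately show ?thesis
    unfolding graph_order_def deg using fin by (metis Suc_eq_plus1 card_insert_disjoint finite_UnI)
qed

lemma out_degree_le_max_degree:
  "v \<in> pverts G \<Longrightarrow> out_degree (with_proj G) v \<le> max_degree G"
  unfolding max_degree_def using pair_finite_verts by (intro Max_ge) auto

lemma max_degree_attained:
  assumes "pverts G \<noteq> {}"
  obtains v where "v \<in> pverts G" "max_degree G = out_degree (with_proj G) v"
proof -
  have "max_degree G \<in> out_degree (with_proj G) ` pverts G"
    unfolding max_degree_def using assms pair_finite_verts by (intro Max_in) auto
  then show ?thesis using that by blast
qed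

end

section \<open>Colour classes when the independence number is two\<close>

locale independence_two_graph = pair_graph +
  assumes independence_number_two: "independence_number G = 2"
begin

lemma finite_independent_cards: "finite {card S | S. independent_set G S}"
proof -
  have "{card S | S. independent_set G S} \<subseteq> card ` Pow (pverts G)"
    by (auto simp: independent_set_def)
  then show ?thesis using pair_finite_verts by (meson finite_Pow_iff finite_imageI finite_subset)
qed

lemma card_independent_le:
  "independent_set G S \<Longrightarrow> card S \<le> 2"
  using independence_number_two finite_independent_cards
  unfolding independence_number_def by (metis (mono_tags, lifting) Max_ge mem_Collect_eq)

text \<open>An independent triple would exceed the independence number. Every clique below arises
  this way, as a set of common non-neighbours of one vertex.\<close>

lemma adjacent_of_three:
  assumes "u \<in> pverts G" "v \<in> pverts G" "x \<in> pverts G" "u \<noteq> v" "v \<noteq> x" "u \<noteq> x"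
    and "(u, v) \<notin> parcs G" "(u, x) \<notin> parcs G"
  shows "(v, x) \<in> parcs G"
proof (rule ccontr)
  assume "(v, x) \<notin> parcs G"
  with assms have "independent_set G {u, v, x}"
    unfolding independent_set_def using no_loop arc_sym by blast
  from card_independent_le[OF this] assms show False by simp
qed

lemma ex_nonadjacent:
  obtains x y where "x \<in> pverts G" "y \<in> pverts G" "x \<noteq> y" "(x, y) \<notin> parcs G"
proof -
  have "independent_set G {}" by (simp add: independent_set_def)
  then have "{card S | S. independent_set G S} \<noteq> {}" by blast
  then have "2 \<in> {card S | S. independent_set G S}"
    using Max_in[OF finite_independent_cards] independence_number_two
    unfolding independence_number_def by metis
  then obtain S where S: "independent_set G S" "card S = 2" by auto
  from S(2) obtain x y where "S = {x, y}" "x \<noteq> y" by (auto simp: card_2_iff)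
  with S(1) show ?thesis using that by (auto simp: independent_set_def)
qed

lemma card_packing_le:
  assumes "packing G i W" "1 \<le> i"
  shows "card W \<le> 2"
proof -
  have "independent_set G W"
    unfolding independent_set_def
    using packing_not_adjacent[OF assms] assms(1) no_loop by (fastforce simp: packing_def)
  then show ?thesis by (rule card_independent_le)
qed

text \<open>Each colour accounts for at most one vertex, plus one more if its class is a pair;
  larger classes are excluded. Few pairs therefore force many colours.\<close>

lemma order_le_colouring:
  assumes "packing_colouring G k W"
  shows "graph_order G \<le> k + card {i \<in> {1..k}. card (W i) = 2}"
proof -
  have "W i \<subseteq> pverts G" if "i \<in> {1..k}" for i
    using assms that by (auto simp: packing_colouring_def packing_def)
  then have fin: "finite (W i)" if "i \<in> {1..k}" for i
    using that pair_finite_verts finite_subset by blast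
  have le: "card (W i) \<le> 2" if "i \<in> {1..k}" for i
    using assms that card_packing_le[of i] by (auto simp: packing_colouring_def)
  have "graph_order G = card (\<Union>i\<in>{1..k}. W i)"
    using assms by (simp add: graph_order_def packing_colouring_def)
  also have "\<dots> = (\<Sum>i\<in>{1..k}. card (W i))"
    using assms fin
    by (intro card_UN_disjoint) (auto simp: packing_colouring_def disjoint_family_on_def)
  also have "\<dots> \<le> (\<Sum>i\<in>{1..k}. 1 + of_bool (card (W i) = 2))"
    using le by (intro sum_mono) (force simp: of_bool_def)
  also have "\<dots> = k + card {i \<in> {1..k}. card (W i) = 2}"
    by (simp only: sum.distrib) (simp add: sum_of_bool_eq Int_def)
  finally show ?thesis .
qed

text \<open>Two vertices at distance greater than 3 have closed neighbourhoods that are disjoint cliques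
  covering the graph with no arcs between them; a clique meets every colour class at most once.\<close>

lemma max_degree_less_colours:
  assumes col: "packing_colouring G k W"
    and uv: "u \<in> pverts G" "v \<in> pverts G" "u \<noteq> v"
    and far: "(u, v) \<notin> parcs G" "\<And>x. (u, x) \<in> parcs G \<Longrightarrow> (x, v) \<notin> parcs G"
      "\<And>x y. (u, x) \<in> parcs G \<Longrightarrow> (x, y) \<in> parcs G \<Longrightarrow> (y, v) \<notin> parcs G"
  shows "max_degree G < k"
proof -
  obtain c where c: "c \<in> pverts G" "max_degree G = out_degree (with_proj G) c"
    using max_degree_attained uv(1) by blast
  let ?K = "insert c (parcs G `` {c})"
  have near: "(u, x) \<in> parcs G \<or> (v, x) \<in> parcs G" if "x \<in> pverts G" "x \<noteq> u" "x \<noteq> v" for x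
    using adjacent_of_three[of u v x] that uv far(1) by blast
  have clique: "(x, y) \<in> parcs G" if xy: "x \<in> ?K" "y \<in> ?K" "x \<noteq> y" for x y
  proof -
    \<comment> \<open>\<open>t\<close> is the one of \<open>u\<close>, \<open>v\<close> that is far
      from \<open>c\<close>. The other one reaches each member of \<open>?K\<close> by a walk of
      length at most two, so no member equals \<open>t\<close> or is adjacent to it, and
      \<open>?K\<close> is a clique.\<close>
    define t where "t = (if c = u \<or> (u, c) \<in> parcs G then v else u)"
    have tv: "t \<in> pverts G" using uv by (simp add: t_def)
    have t: "l \<noteq> t \<and> (t, l) \<notin> parcs G" if "l \<in> ?K" for l
    proof (cases "c = u \<or> (u, c) \<in> parcs G")
      case True
      then have "t = v" by (simp add: t_def)
      with True show ?thesis using that far uv(3) arc_sym by blast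
    next
      case False
      then have "c = v \<or> (v, c) \<in> parcs G" using near c(1) by blast
      moreover have "t = u" using False by (simp add: t_def)
      ultimately show ?thesis using that False far uv(3) arc_sym by blast
    qed
    have "x \<in> pverts G" "y \<in> pverts G" using xy(1,2) c(1) by (auto dest: in_arcsD2)
    then show ?thesis
      using adjacent_of_three[of t x y] t[OF xy(1)] t[OF xy(2)] tv xy(3) by blast
  qed
  have sub: "?K \<subseteq> pverts G" using c(1) by (auto dest: in_arcsD2)
  define colour where "colour x = (SOME i. i \<in> {1..k} \<and> x \<in> W i)" for x
  have colour: "colour x \<in> {1..k} \<and> x \<in> W (colour x)" if "x \<in> ?K" for x
  proof -
    have "\<exists>i. i \<in> {1..k} \<and> x \<in> W i"
      using col sub that unfolding packing_colouring_def by blast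
    then show ?thesis unfolding colour_def by (rule someI_ex)
  qed
  have "inj_on colour ?K"
  proof (rule inj_onI)
    fix x y assume xy: "x \<in> ?K" "y \<in> ?K" "colour x = colour y"
    show "x = y"
    proof (rule ccontr)
      assume "x \<noteq> y"
      have "packing G (colour x) (W (colour x))"
        using col colour[OF xy(1)] unfolding packing_colouring_def by blast
      from packing_not_adjacent[OF this _ _ _ \<open>x \<noteq> y\<close>] clique[OF xy(1,2) \<open>x \<noteq> y\<close>]
      show False using colour[OF xy(1)] colour[OF xy(2)] xy(3) by auto
    qed
  qed
  moreover have "colour ` ?K \<subseteq> {1..k}" using colour by blast
  ultimately have "card ?K \<le> k" using card_inj_on_le[of colour ?K "{1..k}"] by simp
  moreover have "card ?K = max_degree G + 1"
  proof -
    have "pverts G = ?K \<union> non_neighbours c" "?K \<inter> non_neighbours c = {}"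
      using sub by (auto simp: non_neighbours_def)
    then have "graph_order G = card ?K + card (non_neighbours c)"
      unfolding graph_order_def using pair_finite_verts
      by (metis card_Un_disjoint finite_Un)
    then show ?thesis using degree_complement[OF c(1)] c(2) by simp
  qed
  ultimately show ?thesis by simp
qed

section \<open>Recognising members of the class\<close>

text \<open>Here \<open>t\<close> plays the role of \<open>a2\<close>: the clique \<open>A\<close>
  is the closed neighbourhood of \<open>t\<close>, and \<open>B\<close> consists of \<open>w\<close>
  and the neighbours of \<open>z\<close>. The nonadjacent pair \<open>x\<close>, \<open>y\<close>
  supplies \<open>a1\<close> and \<open>b1\<close>.\<close>

lemma class_H_I:
  assumes V: "w \<in> pverts G" "z \<in> pverts G" "t \<in> pverts G"
    and w: "non_neighbours w = {z}"
    and zt: "z \<noteq> t" "(z, t) \<notin> parcs G" "\<And>x. (z, x) \<in> parcs G \<Longrightarrow> (x, t) \<notin> parcs G"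
    and z: "(z, c) \<in> parcs G"
    and xy: "x \<in> pverts G" "y \<in> pverts G" "x \<noteq> y" "(x, y) \<notin> parcs G" "{x, y} \<inter> {z, t} = {}"
  shows "G \<in> class_H"
proof -
  let ?A = "insert t (parcs G `` {t})" and ?B = "insert w (parcs G `` {z})"
  have wz: "w \<noteq> z" "(w, z) \<notin> parcs G" using w by (auto simp: non_neighbours_def)
  have wadj: "(w, l) \<in> parcs G" if "l \<in> pverts G" "l \<noteq> w" "l \<noteq> z" for l
  proof -
    have "l \<notin> non_neighbours w" using w that by simp
    then show ?thesis using that by (simp add: non_neighbours_def)
  qed
  \<comment> \<open>This is where the neighbour \<open>c\<close> of \<open>z\<close> is needed:
    since \<open>w\<close> misses only \<open>z\<close>, it is adjacent to \<open>c\<close>, and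
    \<open>w = t\<close> would give \<open>z\<close> and \<open>t\<close> a common
    neighbour.\<close>
  have wt: "w \<noteq> t"
  proof
    assume "w = t"
    with z zt have "(w, c) \<in> parcs G"
      by (intro wadj) (auto dest: in_arcsD2 simp: no_loop)
    with z zt(3) \<open>w = t\<close> show False using arc_sym by blast
  qed
  have cover: "(z, l) \<in> parcs G \<or> (t, l) \<in> parcs G" if "l \<in> pverts G" "l \<noteq> z" "l \<noteq> t" for l
    using adjacent_of_three[of z t l] that V zt by blast
  have disj: "(z, l) \<notin> parcs G" if "l \<in> ?A" for l
    using that zt arc_sym by blast
  have disj': "l \<noteq> t \<and> (t, l) \<notin> parcs G" if "(z, l) \<in> parcs G" for l
    using that zt arc_sym by blast
  have wA: "w \<in> ?A" using wadj[of t] V wt zt arc_sym by blast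
  have Asub: "?A \<subseteq> pverts G" and Bsub: "?B \<subseteq> pverts G" using V by (auto dest: in_arcsD2)
  have zA: "z \<notin> ?A" and zB: "z \<notin> ?B" using zt arc_sym wz no_loop by auto
  \<comment> \<open>All of \<open>?A\<close> misses \<open>z\<close>; dually, all neighbours of
    \<open>z\<close> miss \<open>t\<close>. Adding \<open>w\<close> to the latter keeps a clique, as
    \<open>w\<close> misses only \<open>z\<close>.\<close>
  have A: "(l, m) \<in> parcs G" if "l \<in> ?A" "m \<in> ?A" "l \<noteq> m" for l m
    using adjacent_of_three[of z l m] that disj Asub V zA by blast
  have N: "(l, m) \<in> parcs G" if "l \<in> parcs G `` {z}" "m \<in> parcs G `` {z}" "l \<noteq> m" for l m
    using adjacent_of_three[of t l m] that disj' Bsub V by blast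
  have B: "(l, m) \<in> parcs G" if "l \<in> ?B" "m \<in> ?B" "l \<noteq> m" for l m
  proof -
    have "(w, l) \<in> parcs G" if "(z, l) \<in> parcs G" "l \<noteq> w" for l
      using wadj[of l] that no_loop in_arcsD2 by blast
    then show ?thesis using that N arc_sym by blast
  qed
  have AB: "?A \<inter> ?B = {w}" using disj wA by blast
  define K where "K S = \<lparr>pverts = S, parcs = {(u, v). (u, v) \<in> S \<times> S \<and> u \<noteq> v}\<rparr>" for S :: "'a set"
  have K: "complete_digraph (card S) (with_proj (K S))" if "S \<subseteq> pverts G" for S
    using that pair_finite_verts by (auto simp: complete_digraph_pair_def K_def intro: finite_subset)
  define H where "H = H_base (K ?A) (K ?B) w z"
  \<comment> \<open>The added edges are exactly those of \<open>G\<close> that the base graph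
    lacks.\<close>
  define F where "F = missing_edges H \<inter> parcs G"
  have pH: "pverts H = pverts G"
    using Asub Bsub V cover by (auto simp: H_def H_base_def K_def)
  have aH: "parcs H = {(u, v). u \<in> ?A \<and> v \<in> ?A \<and> u \<noteq> v} \<union> {(u, v). u \<in> ?B \<and> v \<in> ?B \<and> u \<noteq> v}
      \<union> {z} \<times> (?B - {w}) \<union> (?B - {w}) \<times> {z}"
    by (auto simp: H_def H_base_def K_def)
  have Hsub: "parcs H \<subseteq> parcs G"
    unfolding aH using A B arc_sym by blast
  have Hsym: "sym (parcs H)" unfolding aH sym_def by blast
  have arcs: "parcs G = parcs H \<union> F"
    using Hsub pH no_loop by (auto simp: F_def missing_edges_def dest: in_arcsD1 in_arcsD2)
  have symF: "sym F"
  proof (rule symI)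
    fix u v assume "(u, v) \<in> F"
    then show "(v, u) \<in> F"
      using symD[OF Hsym, of v u] arc_sym[of u v] by (auto simp: F_def missing_edges_def)
  qed
  \<comment> \<open>The base graph already contains every arc of \<open>G\<close> at
    \<open>z\<close> and at \<open>t\<close>, so none is left for \<open>F\<close>.\<close>
  have Fzt: "u \<notin> {z, t} \<and> v \<notin> {z, t}" if "(u, v) \<in> F" for u v
  proof -
    have nH: "(u, v) \<notin> parcs H" "(v, u) \<notin> parcs H" and G: "(u, v) \<in> parcs G"
      using that symD[OF symF that] by (auto simp: F_def missing_edges_def)
    have "(z, w) \<notin> parcs G" using wz arc_sym by blast
    then have "(z, l) \<in> parcs H" if "(z, l) \<in> parcs G" for l
      using that by (auto simp: aH)
    moreover have "(t, l) \<in> parcs H" if "(t, l) \<in> parcs G" for l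
      using that no_loop by (auto simp: aH)
    ultimately show ?thesis using nH G arc_sym[OF G] by blast
  qed
  have G_eq: "G = \<lparr>pverts = pverts H, parcs = parcs H \<union> F\<rparr>"
    using pH arcs by simp
  \<comment> \<open>Neither \<open>x\<close> nor \<open>y\<close> is \<open>w\<close>, whose only
    non-neighbour is \<open>z\<close>. Being nonadjacent, they cannot lie in the same clique, so
    each clique contains one of them.\<close>
  have ends: "\<exists>a1 b1. a1 \<in> ?A \<and> b1 \<in> ?B \<and> a1 \<noteq> t \<and> a1 \<noteq> w \<and> b1 \<noteq> w \<and> (a1, b1) \<notin> parcs G"
  proof -
    have nw: "x \<noteq> w" "y \<noteq> w" using wadj xy arc_sym by blast+
    have mem: "x \<in> ?A \<or> x \<in> ?B" "y \<in> ?A \<or> y \<in> ?B" using cover xy by blast+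
    have "\<not> (x \<in> ?A \<and> y \<in> ?A)" "\<not> (x \<in> ?B \<and> y \<in> ?B)" using A B xy by blast+
    with mem consider "x \<in> ?A" "y \<in> ?B" | "y \<in> ?A" "x \<in> ?B" by blast
    then show ?thesis using nw xy arc_sym by cases blast+
  qed
  then obtain a1 b1 where ab: "a1 \<in> ?A" "b1 \<in> ?B" "a1 \<noteq> t" "a1 \<noteq> w" "b1 \<noteq> w"
    "(a1, b1) \<notin> parcs G" by blast
  note fin = finite_subset[OF Asub pair_finite_verts] finite_subset[OF Bsub pair_finite_verts]
  have "card {a1, t, w} \<le> card ?A" using ab wA fin by (intro card_mono) auto
  then have r: "card ?A \<ge> 3" using ab wt by simp
  have "card {b1, w} \<le> card ?B" using ab fin by (intro card_mono) auto
  then have s: "card ?B \<ge> 2" using ab by simp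
  have pK: "pverts (K S) = S" for S by (simp add: K_def)
  show ?thesis
    unfolding class_H_def mem_Collect_eq
  proof (intro exI conjI)
    show "3 \<le> card ?A" by (rule r)
    show "2 \<le> card ?B" by (rule s)
    show "complete_digraph (card ?A) (with_proj (K ?A))" by (rule K[OF Asub])
    show "complete_digraph (card ?B) (with_proj (K ?B))" by (rule K[OF Bsub])
    show "pverts (K ?A) \<inter> pverts (K ?B) = {w}" using AB by (simp only: pK)
    show "z \<notin> pverts (K ?A) \<union> pverts (K ?B)" using zA zB by (simp only: pK Un_iff) blast
    show "a1 \<in> pverts (K ?A)" using ab(1) by (simp only: pK)
    show "t \<in> pverts (K ?A)" by (simp add: pK)
    show "distinct [a1, t, w]" using ab wt by simp
    show "b1 \<in> pverts (K ?B)" using ab(2) by (simp only: pK)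
    show "b1 \<noteq> w" by (rule ab(5))
    show "F \<subseteq> missing_edges (H_base (K ?A) (K ?B) w z)" unfolding F_def H_def by (rule Int_lower1)
    show "sym F" by (rule symF)
    show "(a1, b1) \<notin> F" using ab(6) by (simp add: F_def)
    show "\<forall>(u, v)\<in>F. u \<notin> {z, t} \<and> v \<notin> {z, t}" using Fzt by blast
    show "G = \<lparr>pverts = pverts (H_base (K ?A) (K ?B) w z),
        parcs = parcs (H_base (K ?A) (K ?B) w z) \<union> F\<rparr>"
      using G_eq unfolding H_def .
  qed
qed

text \<open>With at most two pairs among the classes,
  \<open>n \<le> k + 2 \<le> max_degree G + 2 \<le> n\<close>, so equality holds throughout and both
  pairs exist.\<close>

lemma class_H_if_colours_le_max_degree:
  assumes col: "packing_colouring G k W" and "max_degree G + 2 \<le> graph_order G"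
    and "k \<le> max_degree G"
  shows "G \<in> class_H"
proof -
  have pack: "packing G i (W i)" if "i \<in> {1..k}" for i
    using col that by (simp add: packing_colouring_def)
  \<comment> \<open>Since \<open>k\<close> does not exceed the maximum degree, two vertices at
    distance above three are impossible.\<close>
  have close: "(u, v) \<in> parcs G \<or> (\<exists>x. (u, x) \<in> parcs G \<and> (x, v) \<in> parcs G) \<or>
      (\<exists>x y. (u, x) \<in> parcs G \<and> (x, y) \<in> parcs G \<and> (y, v) \<in> parcs G)"
    if "u \<in> pverts G" "v \<in> pverts G" "u \<noteq> v" for u v
    using max_degree_less_colours[OF col that] assms(3) by force
  let ?I = "{i \<in> {1..k}. card (W i) = 2}"
  have "?I \<subseteq> {1, 2}"
  proof
    fix i assume i: "i \<in> ?I"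
    then obtain u v where uv: "W i = {u, v}" "u \<noteq> v" by (auto simp: card_2_iff)
    have p: "packing G i (W i)" using pack i by blast
    have "\<not> 3 \<le> i"
    proof
      assume "3 \<le> i"
      have "u \<in> pverts G" "v \<in> pverts G" using p uv by (auto simp: packing_def)
      from close[OF this uv(2)] show False
        using packing_not_adjacent[OF p, of u v] packing_no_common_neighbour[OF p, of u v]
          packing_no_3_walk[OF p, of u v] \<open>3 \<le> i\<close> uv by auto
    qed
    with i show "i \<in> {1, 2}" by auto
  qed
  moreover have "card {1::nat, 2} \<le> card ?I"
    using order_le_colouring[OF col] assms(2,3) by simp
  ultimately have I_eq: "?I = {1, 2}" by (intro card_seteq) auto
  then have deg: "max_degree G + 2 = graph_order G"
    using order_le_colouring[OF col] assms(2,3) by simp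
  from I_eq have I: "1 \<in> {1..k}" "card (W 1) = 2" "2 \<in> {1..k}" "card (W 2) = 2" by blast+
  from I(2) obtain x y where xy: "W 1 = {x, y}" "x \<noteq> y" by (auto simp: card_2_iff)
  from I(4) obtain p q where pq: "W 2 = {p, q}" "p \<noteq> q" by (auto simp: card_2_iff)
  note P1 = pack[OF I(1)] and P2 = pack[OF I(3)]
  have V: "x \<in> pverts G" "y \<in> pverts G" "p \<in> pverts G" "q \<in> pverts G"
    using P1 P2 xy pq by (auto simp: packing_def)
  have "(x, y) \<notin> parcs G" using packing_not_adjacent[OF P1] xy by simp
  have d: "{x, y} \<inter> {p, q} = {}"
  proof -
    have "W 1 \<inter> W 2 = {}"
      using col I(1,3) unfolding packing_colouring_def disjoint_family_on_def
      by (metis one_eq_numeral_iff num.distinct(1))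
    then show ?thesis using xy pq by simp
  qed
  have n1: "(p, q) \<notin> parcs G" using packing_not_adjacent[OF P2] pq by simp
  have n2: "(l, q) \<notin> parcs G" if "(p, l) \<in> parcs G" for l
    using packing_no_common_neighbour[OF P2, of p q l] pq that by simp
  \<comment> \<open>The vertices \<open>p\<close> and \<open>q\<close> are at distance exactly
    three; \<open>c\<close> and \<open>c'\<close> are the inner vertices of a shortest walk between
    them.\<close>
  obtain c c' where c: "(p, c) \<in> parcs G" "(c', q) \<in> parcs G"
    using close[OF V(3,4) pq(2)] n1 n2 by blast
  obtain w where w: "w \<in> pverts G" "max_degree G = out_degree (with_proj G) w"
    using max_degree_attained V(1) by blast
  then have "card (non_neighbours w) = 1" using degree_complement[OF w(1)] deg by simp
  then obtain m where m: "non_neighbours w = {m}" by (auto simp: card_1_singleton_iff)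
  \<comment> \<open>Otherwise \<open>w\<close> would have the two non-neighbours \<open>q\<close>
    and \<open>c'\<close>; symmetrically, \<open>w = q\<close> would leave \<open>p\<close> and
    \<open>c\<close>.\<close>
  have "w \<noteq> p"
  proof
    assume "w = p"
    then have "q \<in> non_neighbours w" using V n1 pq by (simp add: non_neighbours_def)
    with m have "non_neighbours w = {q}" by simp
    moreover have "c' \<in> pverts G" "c' \<noteq> q" "c' \<noteq> p" "(p, c') \<notin> parcs G"
      using c n1 n2 no_loop in_arcsD1 by blast+
    ultimately show False using \<open>w = p\<close> by (auto simp: non_neighbours_def)
  qed
  moreover have "w \<noteq> q"
  proof
    assume "w = q"
    then have "p \<in> non_neighbours w" using V n1 pq arc_sym by (auto simp: non_neighbours_def)
    with m have "non_neighbours w = {p}" by simp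
    moreover have "c \<in> pverts G" "c \<noteq> q" "c \<noteq> p" "(q, c) \<notin> parcs G"
      using c n1 n2 no_loop arc_sym in_arcsD2 by blast+
    ultimately show False using \<open>w = q\<close> by (auto simp: non_neighbours_def)
  qed
  \<comment> \<open>Having no common neighbour, \<open>p\<close> and \<open>q\<close> cannot both be
    adjacent to \<open>w\<close>. The one that \<open>w\<close> misses becomes \<open>z\<close>, the
    other \<open>a2\<close>.\<close>
  ultimately have "p \<in> non_neighbours w \<or> q \<in> non_neighbours w"
    using n2[of w] V arc_sym by (auto simp: non_neighbours_def)
  with m consider "non_neighbours w = {p}" | "non_neighbours w = {q}" by auto
  then show ?thesis
  proof cases
    case 1
    show ?thesis
      by (rule class_H_I[OF w(1) V(3,4) 1 pq(2) n1 n2 c(1) V(1,2) xy(2) \<open>(x, y) \<notin> parcs G\<close> d])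
  next
    case 2
    have "(q, p) \<notin> parcs G" "\<And>l. (q, l) \<in> parcs G \<Longrightarrow> (l, p) \<notin> parcs G"
      using n1 n2 arc_sym by blast+
    from class_H_I[OF w(1) V(4,3) 2 pq(2)[symmetric] this arc_sym[OF c(2)] V(1,2) xy(2)
        \<open>(x, y) \<notin> parcs G\<close>] d
    show ?thesis by blast
  qed
qed

section \<open>Computing the packing chromatic number in the two cases\<close>

lemma packing_chromatic_numberI:
  assumes "packing_colouring G k W" "\<And>k W. packing_colouring G k W \<Longrightarrow> m \<le> k" "k \<le> m"
  shows "packing_chromatic_number G = m"
  unfolding packing_chromatic_number_def
  using assms by (intro Least_equality) (auto dest: antisym)

lemma chromatic_number_dominating:
  assumes "max_degree G + 1 = graph_order G"
  shows "packing_chromatic_number G = max_degree G"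
proof -
  obtain x y where xy: "x \<in> pverts G" "y \<in> pverts G" "x \<noteq> y" "(x, y) \<notin> parcs G"
    by (rule ex_nonadjacent)
  obtain v where v: "v \<in> pverts G" "max_degree G = out_degree (with_proj G) v"
    using max_degree_attained xy(1) by blast
  have "finite (non_neighbours v)" using pair_finite_verts by (simp add: non_neighbours_def)
  moreover have "card (non_neighbours v) = 0"
    using degree_complement[OF v(1)] v(2) assms by linarith
  ultimately have "non_neighbours v = {}" by simp
  then have dom: "(v, l) \<in> parcs G" if "l \<in> pverts G" "l \<noteq> v" for l
    using that by (auto simp: non_neighbours_def)
  have vxy: "v \<notin> {x, y}" using dom xy arc_sym by blast
  have P: "packing G 1 {x, y}" using xy arc_sym[of y x] by (intro packing_1I) auto
  \<comment> \<open>A pair and singletons suffice: the number of colours is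
    \<open>2 + (n - 3) = n - 1\<close>.\<close>
  have Q: "packing G 2 {v}" using v by (intro packing_2I) auto
  obtain W where W: "packing_colouring G (2 + card (pverts G - ({x, y} \<union> {v}))) W"
    using packing_colouring_extend[OF P Q] vxy by auto
  have "card (pverts G - ({x, y} \<union> {v})) = graph_order G - 3"
    unfolding graph_order_def using xy v vxy by (subst card_Diff_subset) auto
  moreover have "3 \<le> graph_order G"
    using card_mono[OF pair_finite_verts, of "{v, x, y}"] xy v vxy by (simp add: graph_order_def)
  ultimately have le: "2 + card (pverts G - ({x, y} \<union> {v})) \<le> max_degree G" using assms by simp
  show ?thesis
  proof (rule packing_chromatic_numberI[OF W _ le])
    fix k W assume col: "packing_colouring G k W"
    \<comment> \<open>Any two vertices are adjacent or joined through the dominating vertex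
      \<open>v\<close>, so a pair can only have colour 1.\<close>
    have "{i \<in> {1..k}. card (W i) = 2} \<subseteq> {1}"
    proof
      fix i assume i: "i \<in> {i \<in> {1..k}. card (W i) = 2}"
      then obtain a b where ab: "W i = {a, b}" "a \<noteq> b" by (auto simp: card_2_iff)
      have p: "packing G i (W i)" using i col by (simp add: packing_colouring_def)
      then have V: "a \<in> pverts G" "b \<in> pverts G" using ab by (auto simp: packing_def)
      have "\<not> 2 \<le> i"
        using packing_not_adjacent[OF p, of a b] packing_no_common_neighbour[OF p, of a b v]
          dom[OF V(1)] dom[OF V(2)] ab arc_sym[of v a]
        by (cases "a = v"; cases "b = v") auto
      with i show "i \<in> {1}" by auto
    qed
    then have "card {i \<in> {1..k}. card (W i) = 2} \<le> 1"
      using card_mono[of "{1::nat}"] by fastforce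
    with order_le_colouring[OF col] assms show "max_degree G \<le> k" by simp
  qed
qed

lemma chromatic_number_class_H:
  assumes "G \<in> class_H"
  shows "packing_chromatic_number G = max_degree G"
proof -
  from assms obtain r s A B w z a1 a2 b1 F where
    K: "complete_digraph r (with_proj A)" "complete_digraph s (with_proj B)"
    and AB: "pverts A \<inter> pverts B = {w}" and z: "z \<notin> pverts A \<union> pverts B"
    and a: "a1 \<in> pverts A" "a2 \<in> pverts A" "distinct [a1, a2, w]"
    and b: "b1 \<in> pverts B" "b1 \<noteq> w"
    and F: "F \<subseteq> missing_edges (H_base A B w z)" "(a1, b1) \<notin> F"
      "\<forall>(u, v)\<in>F. u \<notin> {z, a2} \<and> v \<notin> {z, a2}"
    and G: "G = \<lparr>pverts = pverts (H_base A B w z), parcs = parcs (H_base A B w z) \<union> F\<rparr>"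
    unfolding class_H_def by (elim CollectE exE conjE) (rule that; assumption)
  have pG: "pverts G = pverts A \<union> pverts B \<union> {z}"
    using G by (simp add: H_base_def)
  have aG: "parcs G = {(u, v). u \<in> pverts A \<and> v \<in> pverts A \<and> u \<noteq> v}
      \<union> {(u, v). u \<in> pverts B \<and> v \<in> pverts B \<and> u \<noteq> v}
      \<union> {z} \<times> (pverts B - {w}) \<union> (pverts B - {w}) \<times> {z} \<union> F"
    using G K by (simp add: H_base_def complete_digraph_pair_def)
  have w: "w \<in> pverts A" "w \<in> pverts B" using AB by auto
  \<comment> \<open>No added edge meets \<open>z\<close> or \<open>a2\<close>, so their
    neighbourhoods are those of the base graph.\<close>
  have zadj: "(z, l) \<in> parcs G \<longleftrightarrow> l \<in> pverts B - {w}" for l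
    using F(3) z unfolding aG by blast
  have tadj: "(a2, l) \<in> parcs G \<longleftrightarrow> l \<in> pverts A - {a2}" for l
    using F(3) z a AB unfolding aG by auto
  have ab_adj: "(a1, b1) \<notin> parcs G"
    using F(2) z a b AB unfolding aG by auto
  have w_adj: "(w, l) \<in> parcs G" if "l \<in> pverts G" "l \<noteq> w" "l \<noteq> z" for l
    using that w unfolding aG pG by blast
  have V: "w \<in> pverts G" "z \<in> pverts G" "a1 \<in> pverts G" "a2 \<in> pverts G" "b1 \<in> pverts G"
    using pG w a b by auto
  have ne: "a1 \<noteq> b1" "a1 \<noteq> z" "a2 \<noteq> z" "b1 \<noteq> z" "b1 \<noteq> a2" "a1 \<noteq> a2" "w \<noteq> z" "a2 \<noteq> w"
    using a b AB z w by auto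
  have "non_neighbours w = {z}"
  proof -
    have "(w, z) \<notin> parcs G" using zadj[of w] arc_sym[of w z] by blast
    then show ?thesis using w_adj V ne by (auto simp: non_neighbours_def)
  qed
  then have "max_degree G + 2 \<ge> graph_order G"
    using degree_complement[OF V(1)] out_degree_le_max_degree[OF V(1)] by simp
  moreover have "max_degree G + 2 \<le> graph_order G"
  proof -
    obtain v where v: "v \<in> pverts G" "max_degree G = out_degree (with_proj G) v"
      using max_degree_attained V(1) by blast
    \<comment> \<open>No vertex dominates: those of \<open>A\<close> miss \<open>z\<close>, and all
      others miss \<open>a2\<close>.\<close>
    have "non_neighbours v \<noteq> {}"
    proof -
      have "z \<in> non_neighbours v" if "v \<in> pverts A"
        using that zadj[of v] AB arc_sym[of v z] V(2) z unfolding non_neighbours_def by blast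
      moreover have "a2 \<in> non_neighbours v" if "v \<notin> pverts A"
        using that tadj[of v] arc_sym[of v a2] V(4) a(2) unfolding non_neighbours_def by blast
      ultimately show ?thesis by blast
    qed
    moreover have "finite (non_neighbours v)"
      using pair_finite_verts by (simp add: non_neighbours_def)
    ultimately have "1 \<le> card (non_neighbours v)" by (simp add: Suc_le_eq card_gt_0_iff)
    then show ?thesis using degree_complement[OF v(1)] v(2) by simp
  qed
  ultimately have deg: "max_degree G + 2 = graph_order G" by simp
  have P: "packing G 1 {a1, b1}" using V ab_adj arc_sym[of b1 a1] by (intro packing_1I) auto
  have "a2 \<notin> pverts B" using a AB by auto
  then have n1: "(z, a2) \<notin> parcs G" "(a2, z) \<notin> parcs G" using zadj[of a2] tadj[of z] z by blast+
  have n2: "(x, a2) \<notin> parcs G" if "(z, x) \<in> parcs G" for x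
    using that zadj[of x] tadj[of x] AB arc_sym[of x a2] by blast
  have n3: "(x, z) \<notin> parcs G" if "(a2, x) \<in> parcs G" for x
    using that n2[of x] arc_sym[of x z] arc_sym[of a2 x] by blast
  have Q: "packing G 2 {z, a2}"
    by (rule packing_2I) (use V n1 n2 n3 in \<open>blast+\<close>)
  obtain W where W: "packing_colouring G (2 + card (pverts G - ({a1, b1} \<union> {z, a2}))) W"
    using packing_colouring_extend[OF P Q] ne by auto
  have "card (pverts G - ({a1, b1} \<union> {z, a2})) = graph_order G - 4"
    unfolding graph_order_def using V ne by (subst card_Diff_subset) auto
  moreover have "4 \<le> graph_order G"
    using card_mono[OF pair_finite_verts, of "{a1, b1, z, a2}"] V ne by (simp add: graph_order_def)
  ultimately have le: "2 + card (pverts G - ({a1, b1} \<union> {z, a2})) \<le> max_degree G"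
    using deg by simp
  have zb: "(z, b1) \<in> parcs G" "(b1, w) \<in> parcs G"
    using zadj[of b1] b w_adj[of b1] V(5) ne(4) arc_sym[of w b1] by blast+
  show ?thesis
  proof (rule packing_chromatic_numberI[OF W _ le])
    fix k W assume col: "packing_colouring G k W"
    have "{i \<in> {1..k}. card (W i) = 2} \<subseteq> {1, 2}"
    proof
      fix i assume i: "i \<in> {i \<in> {1..k}. card (W i) = 2}"
      then obtain p q where pq: "W i = {p, q}" "p \<noteq> q" by (auto simp: card_2_iff)
      have p: "packing G i (W i)" using i col by (simp add: packing_colouring_def)
      then have Vpq: "p \<in> pverts G" "q \<in> pverts G" using pq by (auto simp: packing_def)
      \<comment> \<open>All distances are at most three: vertices other than \<open>z\<close> are
        joined through \<open>w\<close>, and \<open>z\<close> reaches \<open>w\<close> through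
        \<open>b1\<close>. Of a pair, at least one vertex differs from \<open>z\<close>; it is taken
        as \<open>v\<close>.\<close>
      have no: "False" if "3 \<le> i" "u \<in> W i" "v \<in> W i" "u \<noteq> v" "v \<noteq> z" for u v
      proof -
        have uv: "u \<in> pverts G" "v \<in> pverts G" using p that by (auto simp: packing_def)
        note n = packing_not_adjacent[OF p _ that(2-4)]
          packing_no_common_neighbour[OF p _ that(2-4)] packing_no_3_walk[OF p that(1-4)]
        show False
        proof (cases "v = w")
          case True
          show ?thesis
          proof (cases "u = z")
            case True
            then show ?thesis using n(2)[of b1] zb \<open>v = w\<close> that(1) by auto
          next
            case False
            then have "(w, u) \<in> parcs G" using w_adj[of u] uv(1) that(4) \<open>v = w\<close> by blast
            then show ?thesis using n(1) arc_sym[of w u] that(1) \<open>v = w\<close> by simp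
          qed
        next
          case False
          then have wv: "(w, v) \<in> parcs G" using w_adj[of v] uv(2) that(5) by blast
          consider "u = w" | "u = z" | "(u, w) \<in> parcs G"
            using w_adj[of u] uv(1) arc_sym[of w u] by blast
          then show ?thesis
            using n(1) n(2)[of w] n(3)[of b1 w] wv zb that(1) by cases auto
        qed
      qed
      have "\<not> 3 \<le> i"
      proof
        assume "3 \<le> i"
        then show False using no[of p q] no[of q p] pq by (cases "q = z") auto
      qed
      with i show "i \<in> {1, 2}" by auto
    qed
    then have "card {i \<in> {1..k}. card (W i) = 2} \<le> card {1::nat, 2}"
      by (intro card_mono) auto
    also have "\<dots> = 2" by simp
    finally show "max_degree G \<le> k" using order_le_colouring[OF col] deg by simp
  qed
qed

text \<open>The \<open>LEAST\<close> is meaningful only if some colouring exists; leaving classes 1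
  and 2 empty and giving each vertex its own colour yields one.\<close>

lemma chromatic_number_attained: "\<exists>W. packing_colouring G (packing_chromatic_number G) W"
proof -
  have "packing G 1 {}" "packing G 2 {}" by (simp_all add: packing_def)
  then have "\<exists>k W. packing_colouring G k W" 
    using packing_colouring_extend[of "{}" "{}"] by blast
  then show ?thesis unfolding packing_chromatic_number_def by (rule LeastI_ex)
qed

lemma chromatic_number_eq_max_degreeD:
  assumes "packing_chromatic_number G = max_degree G"
  shows "max_degree G + 1 = graph_order G \<or> G \<in> class_H"
proof -
  obtain W where col: "packing_colouring G (max_degree G) W"
    using chromatic_number_attained assms by auto
  obtain x where "x \<in> pverts G" using ex_nonadjacent by metis
  then obtain v where v: "v \<in> pverts G" "max_degree G = out_degree (with_proj G) v"
    using max_degree_attained by blast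
  show ?thesis
  proof (cases "max_degree G + 1 = graph_order G")
    case False
    then have "max_degree G + 2 \<le> graph_order G" using degree_complement[OF v(1)] v(2) by simp
    then show ?thesis using class_H_if_colours_le_max_degree[OF col] by simp
  qed simp
qed

end

theorem theorem4p2:
  fixes G :: "'a pair_pre_digraph"
  assumes "pair_graph G"
    and "independence_number G = 2"
  shows "int (packing_chromatic_number G) = int (max_degree G) - int (independence_number G) + 2
    \<longleftrightarrow> int (max_degree G) = int (graph_order G) - 1 \<or> G \<in> class_H"
proof -
  interpret independence_two_graph G
    using assms by (simp add: independence_two_graph_def independence_two_graph_axioms_def)
  \<comment> \<open>For independence number two, the integer expression
    \<open>max_degree G - 2 + 2\<close> reduces to the maximum degree.\<close>
  have "packing_chromatic_number G = max_degree G
      \<longleftrightarrow> max_degree G + 1 = graph_order G \<or> G \<in> class_H"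
    using chromatic_number_eq_max_degreeD chromatic_number_dominating chromatic_number_class_H
    by blast
  then show ?thesis using independence_number_two by auto
qed

end
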